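(* Let $\sigma$ be a permutation of $\mathbb{N}_0$. For each $p$ with $1<p<\infty$ there exists a constant $c_p>0$ such that $$\boldsymbol{\varrho}_p(\mathcal{E}_n,\mathcal{W}^\sigma_n)\ \ge\ c_p\,n^{1-1/p}\,\|F^\sigma_n\|_p^{-1}\qquad\text{for } n=1,2,\ldots.$$
   Context: $\mathbb{N}_0=\{0,1,2,\ldots\}$. On $[0,1]$, $e_n(t)=\exp(2\pi i n t)$; $r_0,r_1,\ldots$ are the Rademacher functions ($r_i(t)=\operatorname{sign}\sin(2^{i+1}\pi t)$), and for $n=\sum_{i\ge0}n_i2^i$ with $n_i\in\{0,1\}$ the $n$-th Walsh function is $w_n=\prod_{i\ge 0} r_i^{n_i}$. $\mathcal{E}_n=(e_0,\ldots,e_{n-1})$ and $\mathcal{W}^\sigma_n=(w_{\sigma(0)},\ldots,w_{\sigma(n-1)})$. The quantity $\boldsymbol{\varrho}_p(\mathcal{E}_n,\mathcal{W}^\sigma_n)$ is the smallest constant $c$ such that $\|\sum_{k=0}^{n-1}\xi_k e_k\|_p\le c\,\|\sum_{k=0}^{n-1}\xi_k w_{\sigma(k)}\|_p$ for all complex numbers $\xi_0,\ldots,\xi_{n-1}$, with norms in $L_p[0,1]$. $F^\sigma_n(s,t)=\sum_{k=0}^{n-1}e_k(s)w_{\sigma(k)}(t)$ on $[0,1]^2$, and $\|F^\sigma_n\|_p$ is its norm in $L_p([0,1]^2)$. *)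

theory Defs
  imports "HOL-Analysis.Analysis"
begin

text \<open>
  The norm of \<open>L\<^sub>p(S)\<close>. All functions it is applied to below are bounded and Borel measurable on
  a bounded set, so that the Bochner integral is the actual value of the \<open>L\<^sub>p\<close> integral (and not
  the default value 0 of a non-integrable function).
\<close>

definition Lp_norm :: "real \<Rightarrow> 'a::euclidean_space set \<Rightarrow> ('a \<Rightarrow> complex) \<Rightarrow> real" where
  "Lp_norm p S f = (LINT x:S|lborel. norm (f x) powr p) powr (1 / p)"

definition trig :: "nat \<Rightarrow> real \<Rightarrow> complex" where
  "trig n t = exp (2 * of_real pi * \<i> * of_nat n * of_real t)"

definition rademacher :: "nat \<Rightarrow> real \<Rightarrow> real" where
  "rademacher i t = sgn (sin (2 ^ (i + 1) * pi * t))"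

text \<open>
  The \<open>i\<close>-th binary digit of \<open>n\<close> is 1 iff \<open>bit n i\<close>; factors with digit 0 are omitted from the
  product, which is therefore finite.
\<close>

definition walsh :: "nat \<Rightarrow> real \<Rightarrow> real" where
  "walsh n t = (\<Prod>i | bit n i. rademacher i t)"

lemma finite_bits_nat: "finite {i. bit (n::nat) i}"
proof (rule finite_subset)
  show "{i. bit n i} \<subseteq> {..<n}"
  proof
    fix i assume "i \<in> {i. bit n i}"
    then have "n div 2 ^ i \<noteq> 0" by (auto simp: bit_iff_odd intro!: Nat.gr0I)
    then have "2 ^ i \<le> n" by (meson div_less not_le)
    then show "i \<in> {..<n}" using less_exp[of i] by (simp del: less_exp)
  qed
qed simp

definition walsh_perm :: "(nat \<Rightarrow> nat) \<Rightarrow> nat \<Rightarrow> real \<Rightarrow> complex" where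
  "walsh_perm \<sigma> k t = of_real (walsh (\<sigma> k) t)"

text \<open>
  For systems \<open>(x\<^sub>0, \<dots>, x\<^sub>n\<^sub>-\<^sub>1)\<close> and \<open>(y\<^sub>0, \<dots>, y\<^sub>n\<^sub>-\<^sub>1)\<close> of functions on \<open>[0,1]\<close>, the
  smallest constant \<open>c\<close> such that the norm of every combination of the \<open>x\<^sub>k\<close> is at most \<open>c\<close> times
  that of the corresponding combination of the \<open>y\<^sub>k\<close>. It is taken in the extended nonnegative reals,
  where the infimum is \<open>\<infinity>\<close> if there is no such constant.
\<close>

definition rho :: "real \<Rightarrow> nat \<Rightarrow> (nat \<Rightarrow> real \<Rightarrow> complex) \<Rightarrow> (nat \<Rightarrow> real \<Rightarrow> complex) \<Rightarrow> ennreal" where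
  "rho p n x y = Inf {c. \<forall>\<xi> :: nat \<Rightarrow> complex.
     ennreal (Lp_norm p {0..1} (\<lambda>t. \<Sum>k<n. \<xi> k * x k t))
       \<le> c * ennreal (Lp_norm p {0..1} (\<lambda>t. \<Sum>k<n. \<xi> k * y k t))}"

definition F :: "(nat \<Rightarrow> nat) \<Rightarrow> nat \<Rightarrow> real \<times> real \<Rightarrow> complex" where
  "F \<sigma> n = (\<lambda>(s, t). \<Sum>k<n. trig k s * walsh_perm \<sigma> k t)"

end

theory Submission
  imports Defs
begin

text \<open>
  Let \<open>D = \<Sum>k<n. e\<^sub>k\<close> be the Dirichlet kernel. If \<open>C\<close> is an admissible constant, then its
  defining inequality with the coefficients \<open>\<xi>\<^sub>k = e\<^sub>k(-s)\<close> bounds the norm of the translate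
  \<open>t \<mapsto> D(t - s)\<close> by \<open>C\<close> times the norm of \<open>t \<mapsto> \<Sum>k<n. e\<^sub>k(-s) w\<^bsub>\<sigma>(k)\<^esub>(t)\<close>. Because the Walsh
  functions are real, the latter sum is the complex conjugate of the section \<open>F(s, t)\<close>. Taking
  \<open>p\<close>-th powers and integrating over \<open>s \<in> [0,1]\<close>, Fubini's theorem gives
  \<open>inf\<^sub>s \<parallel>D(\<cdot> - s)\<parallel>\<^sub>p \<le> C \<parallel>F\<parallel>\<^sub>p\<close>.

  It remains to bound the translates of \<open>D\<close> from below, uniformly in \<open>s\<close>. All the \<open>e\<^sub>k\<close>, \<open>k < n\<close>,
  have real part at least 1/2 on \<open>[-1/(6n), 1/(6n)]\<close>, so \<open>D\<close> has modulus at least \<open>n/2\<close> there, and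
  \<open>[0,1]\<close> contains at least one of the two halves of the translate of this interval by \<open>s\<close>. So
  the \<open>p\<close>-th power of the norm is at least \<open>(n/2)\<^sup>p / (6n)\<close>, which is of the order \<open>n\<^sup>p\<^sup>-\<^sup>1\<close>. The
  Walsh functions enter only as bounded Borel measurable real functions; this is the generality of
  \<open>norm_kernel_ge\<close>.
\<close>

text \<open>
  With \<open>\<bar>u\<bar> \<le> 1 / (6 n)\<close> every frequency below \<open>n\<close> turns by an angle of at most \<open>\<pi> / 3\<close>, where the
  cosine is at least 1/2; hence there is no cancellation in the real part.
\<close>

lemma norm_dirichlet_ge_near_0:
  assumes "n \<ge> 1" and u: "\<bar>u\<bar> \<le> 1 / (6 * real n)"
  shows "norm (\<Sum>k<n. trig k u) \<ge> real n / 2"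
proof -
  have "1 / 2 \<le> Re (trig k u)" if "k < n" for k
  proof -
    have "real k * \<bar>u\<bar> \<le> real n * (1 / (6 * real n))"
      using that u by (intro mult_mono) auto
    then have "real k * \<bar>u\<bar> \<le> 1 / 6"
      using assms by simp
    then have "2 * pi * (real k * \<bar>u\<bar>) \<le> 2 * pi * (1 / 6)"
      by (intro mult_left_mono) auto
    then have "\<bar>2 * pi * real k * u\<bar> \<le> pi / 3"
      by (simp add: abs_mult mult.assoc)
    then have "cos (pi / 3) \<le> cos \<bar>2 * pi * real k * u\<bar>"
      by (intro cos_monotone_0_pi_le) auto
    then show ?thesis
      by (simp add: trig_def Re_exp cos_60)
  qed
  then have "(\<Sum>k<n. 1 / 2) \<le> (\<Sum>k<n. Re (trig k u))"
    by (intro sum_mono) auto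
  then have "real n / 2 \<le> Re (\<Sum>k<n. trig k u)"
    by simp
  then show ?thesis
    using complex_Re_le_cmod order_trans by blast
qed

lemma borel_measurable_trig [measurable]: "trig k \<in> borel_measurable borel"
  unfolding trig_def by measurable

lemma norm_trig [simp]: "norm (trig k t) = 1"
  by (simp add: trig_def norm_exp_eq_Re)

lemma trig_diff: "trig k (t - s) = trig k (- s) * trig k t"
  by (simp add: trig_def ring_distribs flip: exp_add)

lemma cnj_trig: "cnj (trig k s) = trig k (- s)"
  by (simp add: trig_def exp_cnj)

lemma borel_measurable_walsh [measurable]: "walsh m \<in> borel_measurable borel"
proof -
  have "(\<lambda>t::real. sgn t) \<in> borel_measurable borel"
    unfolding sgn_if by measurable
  then show ?thesis
    unfolding walsh_def rademacher_def by measurable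
qed

lemma abs_walsh_le_1: "\<bar>walsh m t\<bar> \<le> 1"
  unfolding walsh_def abs_prod by (rule prod_le_1) (auto simp: rademacher_def abs_sgn_eq)

lemma set_integrable_norm_powr_bounded:
  fixes f :: "'a::euclidean_space \<Rightarrow> complex"
  assumes [measurable]: "f \<in> borel_measurable borel" and "compact S"
    and le: "\<And>x. norm (f x) \<le> B" and "0 \<le> p"
  shows "set_integrable lborel S (\<lambda>x. norm (f x) powr p)"
proof -
  have [measurable]: "S \<in> sets borel"
    using \<open>compact S\<close> by (rule borel_compact)
  moreover have "emeasure lborel S < \<infinity>"
    using \<open>compact S\<close> by (intro emeasure_bounded_finite compact_imp_bounded)
  moreover have "norm (f x) powr p \<le> B powr p" for x
    using le \<open>0 \<le> p\<close> by (intro powr_mono2) auto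
  ultimately show ?thesis
    unfolding set_integrable_def
    by (intro integrableI_bounded_set[where A = S and B = "B powr p"]) (auto simp: indicator_def)
qed

lemma Lp_norm_nonneg: "Lp_norm p S f \<ge> 0"
  by (simp add: Lp_norm_def)

lemma Lp_norm_powr:
  assumes "p > 0"
  shows "Lp_norm p S f powr p = (LINT x:S|lborel. norm (f x) powr p)"
proof -
  have "(LINT x:S|lborel. norm (f x) powr p) \<ge> 0"
    unfolding set_lebesgue_integral_def by (intro Bochner_Integration.integral_nonneg) auto
  then show ?thesis
    using assms by (simp add: Lp_norm_def powr_powr)
qed

text \<open>
  The peak of the translate, of height \<open>n / 2\<close> and half-width \<open>1 / (6 n)\<close>, has at least one of its
  halves inside the unit interval.
\<close>

lemma dirichlet_translate_powr_integral_ge: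
  assumes "n \<ge> 1" and "p > 0" and s: "s \<in> {0..1}"
  shows "(LINT t:{0..1}|lborel. norm (\<Sum>k<n. trig k (- s) * trig k t) powr p)
    \<ge> (real n / 2) powr p / (6 * real n)"
proof -
  define h where "h = 1 / (6 * real n)"
  have h: "0 < h" "h \<le> 1 / 2"
    using assms by (auto simp: h_def field_simps)
  \<comment> \<open>Going from \<open>s\<close> towards the far end of the unit interval leaves room for a step \<open>h \<le> 1/2\<close>.\<close>
  define a where "a = (if s \<le> 1 / 2 then s else s - h)"
  have sub: "{a..a + h} \<subseteq> {0..1}" and near: "\<And>t. t \<in> {a..a + h} \<Longrightarrow> \<bar>t - s\<bar> \<le> h"
    using h s by (auto simp: a_def split: if_splits)
  let ?D = "\<lambda>t. norm (\<Sum>k<n. trig k (- s) * trig k t) powr p"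
  have D: "set_integrable lborel {0..1} ?D"
  proof (rule set_integrable_norm_powr_bounded[where B = "real n"])
    show "norm (\<Sum>k<n. trig k (- s) * trig k t) \<le> real n" for t
      by (rule sum_norm_le[THEN order_trans, where g1 = "\<lambda>_. 1"]) (auto simp: norm_mult)
  qed (use \<open>p > 0\<close> in auto)
  have lower: "(real n / 2) powr p \<le> ?D t" if "t \<in> {a..a + h}" for t
    using norm_dirichlet_ge_near_0[of n "t - s"] near[OF that] \<open>n \<ge> 1\<close> \<open>p > 0\<close>
    by (auto simp: h_def trig_diff intro!: powr_mono2)
  have "(LINT t:{a..a + h}|lborel. (real n / 2) powr p) \<le> (LINT t:{a..a + h}|lborel. ?D t)"
    using lower h by (intro set_integral_mono set_integrable_subset[OF D] sub)
      (auto simp: set_integrable_def intro!: integrable_real_indicator)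
  also have "\<dots> \<le> (LINT t:{0..1}|lborel. ?D t)"
    using sub unfolding set_lebesgue_integral_def
    by (intro integral_mono set_integrable_subset[OF D, unfolded set_integrable_def]
        D[unfolded set_integrable_def]) (auto simp: indicator_def)
  finally show ?thesis
    using h by (simp add: set_lebesgue_integral_def h_def)
qed

text \<open>
  The assumed inequality with coefficients \<open>\<xi>\<^sub>k = trig k (-s)\<close> bounds a translate of the Dirichlet
  kernel by the section of \<open>G\<close> at \<open>s\<close>; both sides are raised to the power \<open>p\<close> and averaged over
  \<open>s\<close>. The functions \<open>v k\<close> have to be real so that conjugation exchanges \<open>trig k s\<close> and
  \<open>trig k (-s)\<close> while leaving them alone.
\<close>

lemma norm_kernel_ge:
  fixes v :: "nat \<Rightarrow> real \<Rightarrow> real"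
  assumes n: "n \<ge> 1" and p: "p > 0" and C: "C \<ge> 0"
    and v [measurable]: "\<And>k. v k \<in> borel_measurable borel" and bound: "\<And>k t. \<bar>v k t\<bar> \<le> B"
    and le: "\<And>\<xi>. Lp_norm p {0..1} (\<lambda>t. \<Sum>k<n. \<xi> k * trig k t)
      \<le> C * Lp_norm p {0..1} (\<lambda>t. \<Sum>k<n. \<xi> k * of_real (v k t))"
  defines "G \<equiv> \<lambda>(s, t). \<Sum>k<n. trig k s * of_real (v k t)"
  shows "real n / 2 * (6 * real n) powr (- 1 / p) \<le> C * Lp_norm p ({0..1} \<times> {0..1}) G"
proof -
  define A where "A = (real n / 2) powr p / (6 * real n)"
  define g where "g = (\<lambda>z. indicator ({0..1} \<times> {0..1}) z *\<^sub>R norm (G z) powr p)"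
  define I where "I s = (LINT t:{0..1}|lborel. norm (G (s, t)) powr p)" for s
  have [measurable]: "G \<in> borel_measurable borel"
    unfolding G_def borel_prod[symmetric] by measurable
  have G_le: "norm (G z) \<le> real n * B" for z
    unfolding G_def case_prod_beta
    by (rule sum_norm_le[THEN order_trans, where g1 = "\<lambda>_. B"]) (auto simp: norm_mult bound)
  have int: "integrable (lborel \<Otimes>\<^sub>M lborel) g"
    using set_integrable_norm_powr_bounded[of G "{0..1} \<times> {0..1}" "real n * B" p] G_le p
    by (simp add: lborel_prod g_def set_integrable_def compact_Times)
  have sec: "(LINT t|lborel. g (s, t)) = indicator {0..1} s *\<^sub>R I s" for s
    by (simp add: g_def I_def set_lebesgue_integral_def indicator_times mult.assoc)
  have intI: "set_integrable lborel {0..1} I"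
    using lborel_pair.integrable_fst'[OF int] by (simp add: sec set_integrable_def)
  have Fubini: "(LINT s:{0..1}|lborel. I s) = Lp_norm p ({0..1} \<times> {0..1}) G powr p"
    using lborel_pair.integral_fst'[OF int, unfolded sec] p
    by (simp add: Lp_norm_powr set_lebesgue_integral_def g_def lborel_prod)
  have A_le: "A \<le> C powr p * I s" if "s \<in> {0..1}" for s
  proof -
    have "cnj (G (s, t)) = (\<Sum>k<n. trig k (- s) * of_real (v k t))" for t
      by (simp add: G_def cnj_trig)
    then have *: "norm (\<Sum>k<n. trig k (- s) * of_real (v k t)) = norm (G (s, t))" for t
      by (metis complex_mod_cnj)
    have "A \<le> Lp_norm p {0..1} (\<lambda>t. \<Sum>k<n. trig k (- s) * trig k t) powr p"
      using dirichlet_translate_powr_integral_ge[OF n p that] p by (simp add: A_def Lp_norm_powr)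
    also have "\<dots> \<le> (C * Lp_norm p {0..1} (\<lambda>t. \<Sum>k<n. trig k (- s) * of_real (v k t))) powr p"
      using p by (intro powr_mono2 le Lp_norm_nonneg) auto
    also have "\<dots> = C powr p * I s"
      using C p by (simp add: powr_mult Lp_norm_nonneg Lp_norm_powr * I_def)
    finally show ?thesis .
  qed
  have "A = (LINT s:{0..1::real}|lborel. A)"
    by (simp add: set_lebesgue_integral_def)
  also have "\<dots> \<le> (LINT s:{0..1}|lborel. C powr p * I s)"
    using A_le intI by (intro set_integral_mono set_integrable_mult_right)
      (auto simp: set_integrable_def)
  also have "\<dots> = (C * Lp_norm p ({0..1} \<times> {0..1}) G) powr p"
    using C by (simp add: Fubini powr_mult Lp_norm_nonneg)
  finally have "A powr (1 / p) \<le> ((C * Lp_norm p ({0..1} \<times> {0..1}) G) powr p) powr (1 / p)"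
    using p by (intro powr_mono2) (auto simp: A_def)
  then show ?thesis
    using p n C by (simp add: A_def powr_powr powr_divide powr_mult Lp_norm_nonneg powr_minus_divide)
qed

theorem proposition3p1:
  fixes \<sigma> :: "nat \<Rightarrow> nat" and p :: real
  assumes "bij \<sigma>" and "1 < p"
  shows "\<exists>c::real. c > 0 \<and> (\<forall>n::nat. n \<ge> 1 \<longrightarrow>
    rho p n trig (walsh_perm \<sigma>) \<ge>
      ennreal (c * real n powr (1 - 1 / p) * inverse (Lp_norm p ({0..1} \<times> {0..1}) (F \<sigma> n))))"
proof -
  define c where "c = 6 powr (- 1 / p) / 2"
  have "ennreal (c * real n powr (1 - 1 / p) * inverse (Lp_norm p ({0..1} \<times> {0..1}) (F \<sigma> n)))
      \<le> rho p n trig (walsh_perm \<sigma>)" (is "ennreal (_ * inverse ?N) \<le> _") if n: "n \<ge> 1" for n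
    unfolding rho_def
  proof (rule Inf_greatest, clarify)
    fix C :: ennreal
    assume adm: "\<forall>\<xi>. ennreal (Lp_norm p {0..1} (\<lambda>t. \<Sum>k<n. \<xi> k * trig k t))
      \<le> C * ennreal (Lp_norm p {0..1} (\<lambda>t. \<Sum>k<n. \<xi> k * walsh_perm \<sigma> k t))"
    show "ennreal (c * real n powr (1 - 1 / p) * inverse ?N) \<le> C"
    proof (cases C)
      case (real r)
      have "Lp_norm p {0..1} (\<lambda>t. \<Sum>k<n. \<xi> k * trig k t)
          \<le> r * Lp_norm p {0..1} (\<lambda>t. \<Sum>k<n. \<xi> k * of_real (walsh (\<sigma> k) t))" for \<xi>
        using adm[rule_format, of \<xi>] real
        by (simp add: walsh_perm_def Lp_norm_nonneg flip: ennreal_mult)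
      from norm_kernel_ge[OF n _ real(1) _ abs_walsh_le_1 this] \<open>1 < p\<close>
      have "real n / 2 * (6 * real n) powr (- 1 / p) \<le> r * ?N"
        by (simp add: F_def walsh_perm_def)
      also have "real n / 2 * (6 * real n) powr (- 1 / p) = c * real n powr (1 - 1 / p)"
        using n by (simp add: c_def powr_mult powr_diff powr_minus_divide)
      finally have main: "c * real n powr (1 - 1 / p) \<le> r * ?N" .
      have "0 < c * real n powr (1 - 1 / p)"
        using n by (simp add: c_def)
      with main have "?N > 0"
        using Lp_norm_nonneg[of p "{0..1} \<times> {0..1}" "F \<sigma> n"] by (cases "?N = 0") auto
      with main have "c * real n powr (1 - 1 / p) * inverse ?N \<le> r"
        by (simp add: field_simps)
      then show ?thesis
        using real by (simp add: ennreal_leI)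
    qed simp
  qed
  moreover have "c > 0"
    by (simp add: c_def)
  ultimately show ?thesis
    by blast
qed

end
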